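(* Let $N$ be any positive integer. Then there exist integers $a$ and $M\geq 1$ such that every element of the residue class $\{x\in\mathbb{Z}: x\equiv a \pmod M\}$ is odd, and for each nonnegative integer $x$ in this residue class, each $m\in\{1,\ldots,N\}$ divisible by none of $3,5,7,11,13$, and each $n\in\{0,1,2,\ldots\}$, the integer $x^m-2^n$ has at least two distinct prime factors. *)

theory Defs
  imports "HOL-Number_Theory.Number_Theory"
begin

end

theory Submission imports Defs
begin

text \<open>
  Let the classes \<open>b\<^sub>s mod n\<^sub>s\<close> cover the integers and let \<open>p\<^sub>s\<close> be distinct primes such that \<open>2\<close> has
  order \<open>n\<^sub>s\<close> modulo \<open>p\<^sub>s\<close>, every \<open>n\<^sub>s\<close> being a product of primes among 3, 5, 7, 11, 13. If
  \<open>x \<equiv> 2^b\<^sub>s (mod p\<^sub>s)\<close> for all \<open>s\<close> and \<open>m\<close> is prime to the \<open>n\<^sub>s\<close>, then the classes \<open>m b\<^sub>s mod n\<^sub>s\<close> are again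
  a cover, so every \<open>x^m - 2^n\<close> is divisible by some \<open>p\<^sub>s\<close>.

  It remains to avoid the values \<open>0\<close> and \<open>\<plusminus> p\<^sub>s^k\<close>. Take auxiliary primes \<open>q\<close>, different from the
  \<open>p\<^sub>s\<close>, all with \<open>q - 1\<close> dividing one number \<open>L\<close>, and require \<open>x\<close> to be 0 or 1 modulo each of them;
  then \<open>x^m \<equiv> x\<close> for all \<open>m\<close>. Modulo the product of the \<open>q\<close>, the expressions \<open>2^n + c p\<^sub>s^k\<close> with
  \<open>c = -1, 0, 1\<close> depend only on the exponents modulo \<open>L\<close>, so they take fewer values than there are 0-1
  assignments, and some assignment is never hit. This choice serves all exponents \<open>m\<close> at once.
\<close>

subsection \<open>Reduction to a cover\<close>

lemma cong_pow_of_cong_exponent: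
  fixes u q d n k :: nat
  assumes "[u ^ d = 1] (mod q)" "[n = k] (mod d)"
  shows "[u ^ n = u ^ k] (mod q)"
proof -
  have *: "[u ^ j = u ^ (j mod d)] (mod q)" for j
  proof -
    have "[(u ^ d) ^ (j div d) * u ^ (j mod d) = 1 ^ (j div d) * u ^ (j mod d)] (mod q)"
      using assms(1) by (intro cong_mult cong_pow cong_refl)
    then show ?thesis
      by (simp flip: power_mult power_add)
  qed
  have "n mod d = k mod d"
    using assms(2) by (simp add: cong_def)
  then show ?thesis
    using *[of n] *[of k] by (metis cong_sym cong_trans)
qed

lemma cong_pow_mod_exponent:
  fixes u q L n :: nat
  assumes "prime q" "\<not> q dvd u" "(q - 1) dvd L"
  shows "[u ^ n = u ^ (n mod L)] (mod q)"
proof (rule cong_pow_of_cong_exponent)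
  have "[u ^ (q - 1) = 1] (mod q)"
    using assms fermat_theorem by blast
  then show "[u ^ L = 1] (mod q)"
    using assms(3) by (metis cong_pow dvdE power_mult power_one)
qed (simp add: cong_def)

lemma prime_power_of_card_prime_factors:
  fixes y :: int and p :: nat
  assumes "y \<noteq> 0" "prime p" "int p dvd y" "card (prime_factors y) < 2"
  shows "\<exists>c \<in> {-1, 1}. \<exists>k. y = c * int p ^ k"
proof -
  have mem: "int p \<in> prime_factors y"
    using assms by (simp add: prime_factors_dvd)
  then have "card (prime_factors y) = 1"
    using assms(4) card_gt_0_iff[of "prime_factors y"] by fastforce
  then have *: "prime_factors y = {int p}"
    using mem by (metis card_1_singletonE singletonD)
  have "\<bar>y\<bar> = (\<Prod>q \<in> prime_factors y. q ^ multiplicity q y)"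
    using assms(1) prod_prime_factors[of y] by (simp add: normalize_int_def abs_if sgn_if)
  then have "\<bar>y\<bar> = int p ^ multiplicity (int p) y"
    by (simp add: *)
  then show ?thesis
    by (metis abs_if insertI1 insertI2 minus_minus mult_1 mult_minus1)
qed

lemma avoid_residues:
  fixes P Q :: "nat set" and L :: nat
  assumes "finite P" "finite Q" and L: "L > 0"
    and Q: "\<And>q. q \<in> Q \<Longrightarrow> prime q \<and> odd q \<and> (q - 1) dvd L" 
    and P: "\<And>p. p \<in> P \<Longrightarrow> prime p" and PQ: "P \<inter> Q = {}"
    and card: "3 * card P * L\<^sup>2 < 2 ^ card Q"
  shows "\<exists>v. (\<forall>q\<in>Q. v q \<in> {0, 1 :: nat}) \<and>
    (\<forall>p\<in>P. \<forall>c\<in>{-1, 0, 1}. \<forall>n k. \<exists>q\<in>Q. \<not> [int (v q) = 2 ^ n + c * int p ^ k] (mod int q))"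
proof -
  \<comment> \<open>With exponents reduced modulo \<open>L\<close> only the targets
    \<open>w i\<close> for \<open>i \<in> I\<close> remain; \<open>g\<close> lists the residues of a
    target at all of \<open>Q\<close>, and a 0-1 assignment outside its image is wanted.\<close>
  define I where "I = P \<times> {-1, 0, 1 :: int} \<times> {..<L} \<times> {..<L}"
  define w where "w = (\<lambda>(p, c, n, k). 2 ^ n + c * int p ^ k)"
  define g where "g = (\<lambda>i. restrict (\<lambda>q. nat (w i mod int q)) Q)"
  have "card (g ` I) \<le> card I"
    by (rule card_image_le) (simp add: I_def assms)
  also have "card I = 3 * card P * L\<^sup>2"
    by (simp add: I_def card_cartesian_product power2_eq_square)
  also have "\<dots> < card (PiE Q (\<lambda>_. {0, 1 :: nat}))"
    using card \<open>finite Q\<close> by (simp add: card_PiE numeral_2_eq_2)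
  finally have less: "card (g ` I) < card (PiE Q (\<lambda>_. {0, 1 :: nat}))" .
  have "\<not> PiE Q (\<lambda>_. {0, 1 :: nat}) \<subseteq> g ` I"
  proof
    assume "PiE Q (\<lambda>_. {0, 1 :: nat}) \<subseteq> g ` I"
    moreover have "finite (g ` I)"
      by (simp add: I_def assms(1))
    ultimately have "card (PiE Q (\<lambda>_. {0, 1 :: nat})) \<le> card (g ` I)"
      by (intro card_mono)
    with less show False
      by simp
  qed
  then obtain v where v: "v \<in> PiE Q (\<lambda>_. {0, 1})" and vg: "v \<notin> g ` I"
    by blast
  have v01: "v q \<in> {0, 1}" if "q \<in> Q" for q
    using v that by (rule PiE_mem)
  have "\<exists>q\<in>Q. \<not> [int (v q) = 2 ^ n + c * int p ^ k] (mod int q)"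
    if "p \<in> P" "c \<in> {-1, 0, 1}" for p c n k
  proof (rule ccontr)
    assume *: "\<not> ?thesis"
    let ?i = "(p, c, n mod L, k mod L)"
    have "v q = g ?i q" if q: "q \<in> Q" for q
    proof -
      \<comment> \<open>As \<open>q\<close> is odd and outside \<open>P\<close>, both 2 and
        \<open>p\<close> are units modulo \<open>q\<close>, so Fermat applies to both
        powers.\<close>
      have "q \<noteq> p" "q \<noteq> 2" "prime q"
        using Q[OF q] q PQ \<open>p \<in> P\<close> by auto
      then have "\<not> q dvd 2" "\<not> q dvd p"
        using P[OF \<open>p \<in> P\<close>] primes_dvd_imp_eq two_is_prime_nat by blast+
      then have "[2 ^ n = 2 ^ (n mod L)] (mod q)" "[p ^ k = p ^ (k mod L)] (mod q)"
        using Q[OF q] by (simp_all add: cong_pow_mod_exponent)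
      then have "[int (2 ^ n) = int (2 ^ (n mod L))] (mod int q)" "[int (p ^ k) = int (p ^ (k mod L))] (mod int q)"
        by (simp_all only: cong_int_iff)
      then have "[2 ^ n + c * int p ^ k = w ?i] (mod int q)"
        unfolding w_def prod.case by (intro cong_add cong_scalar_left) simp_all
      then have "[int (v q) = w ?i] (mod int q)"
        using * q cong_trans by blast
      moreover have "v q < q"
        using v01[OF q] prime_gt_1_nat[OF \<open>prime q\<close>] by auto
      ultimately have "int (v q) = w ?i mod int q"
        by (metis cong_def of_nat_mod mod_less)
      then show ?thesis
        using q by (metis g_def nat_int restrict_apply')
    qed
    then have "v = g ?i"
      using PiE_arb[OF v] by (auto simp: g_def restrict_def)
    moreover have "?i \<in> I"
      using that L by (simp add: I_def)
    ultimately show False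
      using vg by blast
  qed
  then show ?thesis
    using v01 by blast
qed

lemma progression_of_cover:
  fixes P Q :: "nat set" and r e :: "nat \<Rightarrow> nat" and L L0 :: nat
  assumes fin: "finite P" "finite Q"
    and P: "\<And>p. p \<in> P \<Longrightarrow> prime p \<and> odd p \<and> [2 ^ e p = 1] (mod p) \<and> e p dvd L0"
    and cover: "\<And>x :: nat. \<exists>p\<in>P. [x = r p] (mod e p)"
    and L: "L > 0"
    and Q: "\<And>q. q \<in> Q \<Longrightarrow> prime q \<and> odd q \<and> (q - 1) dvd L"
    and PQ: "P \<inter> Q = {}"
    and card: "3 * card P * L\<^sup>2 < 2 ^ card Q"
  shows "\<exists>a M :: int. M \<ge> 1 \<and> (\<forall>x. [x = a] (mod M) \<longrightarrow> odd x \<and>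
    (\<forall>m n. coprime m L0 \<longrightarrow> m \<ge> 1 \<longrightarrow> card (prime_factors (x ^ m - 2 ^ n)) \<ge> 2))"
proof -
  obtain v :: "nat \<Rightarrow> nat" where v: "\<And>q. q \<in> Q \<Longrightarrow> v q \<in> {0, 1}" and
    v': "\<And>p c n k. p \<in> P \<Longrightarrow> c \<in> {-1, 0, 1} \<Longrightarrow>
      \<exists>q\<in>Q. \<not> [int (v q) = 2 ^ n + c * int p ^ k] (mod int q)"
    using avoid_residues[of P Q L] assms by metis
  define A where "A = insert 2 (P \<union> Q)"
  \<comment> \<open>The residue 1 at 2 makes \<open>x\<close> odd; the last case serves the primes
    of \<open>P\<close>, which avoid 2 and \<open>Q\<close>.\<close>
  define u where "u = (\<lambda>q. if q = 2 then 1 else if q \<in> Q then v q else 2 ^ r q)"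
  have A: "finite A" "\<And>q. q \<in> A \<Longrightarrow> prime q"
    using fin P Q by (auto simp: A_def)
  then have "\<forall>i\<in>A. \<forall>j\<in>A. i \<noteq> j \<longrightarrow> coprime (id i) (id j)"
    by (simp add: primes_coprime)
  from chinese_remainder_nat[OF A(1) this, of u]
  obtain a where a: "\<And>q. q \<in> A \<Longrightarrow> [a = u q] (mod q)"
    by auto
  show ?thesis
  proof (intro exI conjI allI impI)
    show "int (\<Prod>A) \<ge> 1"
      using A prime_gt_0_nat by (metis int_one_le_iff_zero_less of_nat_0_less_iff prod_pos)
    fix x :: int assume x: "[x = int a] (mod int (\<Prod>A))"
    have xq: "[x = int (u q)] (mod int q)" if "q \<in> A" for q
    proof -
      have "int q dvd int (\<Prod>A)"
        using A(1) that by (simp add: dvd_prodI)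
      then have "[x = int a] (mod int q)"
        using x by (rule cong_dvd_modulus[rotated])
      also have "[int a = int (u q)] (mod int q)"
        using a[OF that] by (simp add: cong_int_iff)
      finally show ?thesis .
    qed
    show odd: "odd x"
      using xq[of 2] by (simp add: A_def u_def cong_def odd_iff_mod_2_eq_one)
    fix m n :: nat assume m: "coprime m L0" "m \<ge> 1"
    \<comment> \<open>\<open>m\<close> is invertible modulo \<open>L0\<close>; the cover is applied
      to the solution \<open>i\<close> of \<open>m * i = n\<close> modulo \<open>L0\<close>, not to
      \<open>n\<close> itself.\<close>
    obtain i0 where "[m * i0 = 1] (mod L0)"
      using cong_solve_coprime_nat[OF m(1)] by auto
    from cong_scalar_right[OF this, of n] obtain i where i: "[m * i = n] (mod L0)"
      by (metis mult.assoc mult_1)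
    obtain p where p: "p \<in> P" and ip: "[i = r p] (mod e p)"
      using cover by blast
    have "p \<notin> Q" "p \<noteq> 2" "p \<in> A" "prime p" "odd p"
      using PQ p P[OF p] by (auto simp: A_def)
    then have up: "u p = 2 ^ r p"
      by (simp add: u_def)
    have "[r p * m = i * m] (mod e p)"
      by (rule cong_scalar_right[OF cong_sym[OF ip]])
    also have "[i * m = n] (mod e p)"
      using cong_dvd_modulus_nat[OF i, of "e p"] P[OF p] by (simp add: mult.commute)
    finally have "[2 ^ (r p * m) = 2 ^ n] (mod p)"
      using P[OF p] by (intro cong_pow_of_cong_exponent[of _ "e p"]) auto
    then have "[(2 ^ r p) ^ m = 2 ^ n] (mod p)"
      by (simp add: power_mult)
    then have "[int (u p) ^ m = 2 ^ n] (mod int p)"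
      by (metis up cong_int_iff of_nat_power of_nat_numeral)
    then have "[x ^ m = 2 ^ n] (mod int p)"
      using cong_pow[OF xq[OF \<open>p \<in> A\<close>]] cong_trans by blast
    then have dvd: "int p dvd x ^ m - 2 ^ n"
      by (simp add: cong_iff_dvd_diff)
    have no: "x ^ m - 2 ^ n \<noteq> c * int p ^ k" if c: "c \<in> {-1, 0, 1}" for c k
    proof
      assume eq: "x ^ m - 2 ^ n = c * int p ^ k"
      obtain q where q: "q \<in> Q" and not: "\<not> [int (v q) = 2 ^ n + c * int p ^ k] (mod int q)"
        using v'[OF p c] by blast
      have "u q = v q"
        using q Q[OF q] by (auto simp: u_def)
      then have "[x ^ m = int (v q) ^ m] (mod int q)"
        using xq[of q] q by (auto simp: A_def intro: cong_pow)
      moreover have "int (v q) ^ m = int (v q)"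
        using v[OF q] m(2) by auto
      moreover have "x ^ m = 2 ^ n + c * int p ^ k"
        using eq by simp
      ultimately show False
        using not by (simp add: cong_sym)
    qed
    show "card (prime_factors (x ^ m - 2 ^ n)) \<ge> 2"
    proof (rule ccontr)
      assume "\<not> ?thesis"
      moreover have "x ^ m - 2 ^ n \<noteq> 0"
        using no[of 0] by simp
      ultimately obtain c k where "c \<in> {-1, 1}" "x ^ m - 2 ^ n = c * int p ^ k"
        using prime_power_of_card_prime_factors[OF _ \<open>prime p\<close> dvd] by fastforce
      then show False
        using no[of c k] by blast
    qed
  qed
qed

subsection \<open>Certified orders of 2\<close>

text \<open>With y = 2^(n/r) the sum is 1 + y + ... + y^(r-1), so \<open>p\<close> divides y^r - 1 =
  2^n - 1. If y were 1 modulo \<open>p\<close>, the sum would be r there, which \<open>p\<close>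
  does not divide. Hence the order divides \<open>n\<close> but no n/r.\<close>

lemma ord_two_eqI:
  fixes p n :: nat
  assumes "prime p" "n > 0"
    and sums: "\<And>r. prime r \<Longrightarrow> r dvd n \<Longrightarrow> p dvd (\<Sum>i<r. 2 ^ (n div r * i)) \<and> \<not> p dvd r"
    and n1: "n \<noteq> 1"
  shows "ord p 2 = n"
proof -
  have one: "[2 ^ n = 1] (mod p) \<and> \<not> [2 ^ (n div r) = 1] (mod p)" if r: "prime r" "r dvd n" for r
  proof -
    define y :: int where "y = 2 ^ (n div r)"
    have dvd: "int p dvd (\<Sum>i<r. y ^ i)"
    proof -
      have "int p dvd int (\<Sum>i<r. 2 ^ (n div r * i))"
        using sums[OF r] by (simp only: of_nat_dvd_iff)
      then show ?thesis
        by (simp add: y_def power_mult)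
    qed
    have yn: "y ^ r = 2 ^ n"
      using r by (simp add: y_def flip: power_mult)
    have "int p dvd y ^ r - 1"
      using dvd by (simp add: power_diff_1_eq)
    then have "[2 ^ n = 1] (mod int p)"
      by (simp add: yn cong_iff_dvd_diff)
    then have 1: "[2 ^ n = 1] (mod p)"
      by (metis cong_int_iff of_nat_1 of_nat_numeral of_nat_power)
    have "\<not> [2 ^ (n div r) = 1] (mod p)"
    proof
      assume "[2 ^ (n div r) = 1] (mod p)"
      then have y1: "[y = 1] (mod int p)"
        unfolding y_def by (metis cong_int_iff of_nat_1 of_nat_numeral of_nat_power)
      have "[(\<Sum>i<r. y ^ i) = (\<Sum>i<r. 1 ^ i)] (mod int p)"
        by (intro cong_sum cong_pow y1)
      then have "int p dvd int r"
        using dvd by (simp add: cong_dvd_iff)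
      then show False
        using sums[OF r] by simp
    qed
    with 1 show ?thesis by blast
  qed
  obtain r0 where "prime r0" "r0 dvd n"
    using n1 by (meson prime_factor_nat)
  then have "ord p 2 dvd n"
    using one by (simp add: ord_divides')
  then obtain k where k: "n = ord p 2 * k"
    by (elim dvdE)
  have "k = 1"
  proof (rule ccontr)
    assume "k \<noteq> 1"
    then obtain r where r: "prime r" "r dvd k"
      by (meson prime_factor_nat)
    then have "n div r = ord p 2 * (k div r)"
      by (simp add: k div_mult_swap)
    then have "ord p 2 dvd n div r"
      by simp
    then show False
      using one[of r] r k by (simp add: ord_divides')
  qed
  then show ?thesis
    using k by simp
qed

section \<open>Iterated halving modulo an odd number, on binary numerals\<close>

primrec iterate :: "num \<Rightarrow> ('a \<Rightarrow> 'a) \<Rightarrow> 'a \<Rightarrow> 'a" where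
  "iterate num.One g x = g x"
| "iterate (num.Bit0 k) g x = iterate k g (iterate k g x)"
| "iterate (num.Bit1 k) g x = g (iterate k g (iterate k g x))"

lemma iterate_eq_funpow: "iterate k g x = (g ^^ numeral k) x"
  by (induction k arbitrary: x)
    (simp_all only: iterate.simps numeral.simps One_nat_def add_Suc_right add_0_right
      funpow.simps funpow_add o_apply id_apply)

text \<open>
  Division by two modulo the odd number \<open>d = 2 h - 1\<close>. Binary numerals have their last digit outermost,
  so this costs at most one addition.
\<close>

fun half :: "num \<Rightarrow> num \<Rightarrow> num" where
  "half h num.One = h"
| "half h (num.Bit0 x) = x"
| "half h (num.Bit1 x) = x + h"

definition inc_halves :: "num \<Rightarrow> num \<Rightarrow> num \<Rightarrow> num" where
  "inc_halves h s x = Num.inc (iterate s (half h) x)"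

text \<open>The doubled value is x or x + D: for odd x = 2y + 1, 2(y + h) = 2y + D + 1 = x +
  D.\<close>

lemma cong_half:
  fixes D :: int
  assumes "2 * numeral h = D + 1"
  shows "[2 * numeral (half h x) = numeral x] (mod D)"
proof -
  have "2 * numeral (half h x) = (numeral x :: int) \<or> 2 * numeral (half h x) = numeral x + D"
  proof (cases x)
    case One
    have "2 * numeral h = 1 + D"
      using assms by linarith
    then show ?thesis
      unfolding One half.simps numeral_One by (rule disjI2)
  next
    case (Bit0 y)
    then show ?thesis
      by (intro disjI1) (simp only: half.simps numeral_Bit0[of y] mult_2)
  next
    case (Bit1 y)
    have "2 * (numeral y + numeral h) = numeral y + numeral y + 1 + (D :: int)"
      unfolding distrib_left assms by (simp only: mult_2 add_ac)
    then show ?thesis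
      unfolding Bit1 half.simps numeral_Bit1[of y] numeral_add by (rule disjI2)
  qed
  then show ?thesis
    unfolding cong_def by (metis mod_add_self2)
qed

lemma cong_funpow_half:
  fixes D :: int
  assumes "2 * numeral h = D + 1"
  shows "[2 ^ s * numeral ((half h ^^ s) x) = numeral x] (mod D)"
proof (induction s)
  case (Suc s)
  let ?y = "(half h ^^ s) x"
  have "[2 ^ s * (2 * numeral (half h ?y)) = 2 ^ s * numeral ?y] (mod D)"
    by (intro cong_scalar_left cong_half assms)
  also note Suc.IH
  finally show ?case
    by (simp only: power_Suc2 mult.assoc funpow.simps o_apply)
qed simp

text \<open>Horner's scheme in 1/2^S: \<open>j\<close> steps from 1 give the sum of 2^(-S i) for i =
  0..j, and the factor 2^(S j) clears the denominators.\<close>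

lemma cong_funpow_inc_halves:
  fixes D :: int
  assumes "2 * numeral h = D + 1" "numeral s = S"
  shows "[2 ^ (S * j) * numeral ((inc_halves h s ^^ j) num.One) = (\<Sum>i<Suc j. 2 ^ (S * i))] (mod D)"
proof (induction j)
  case (Suc j)
  define x where "x = (inc_halves h s ^^ j) num.One"
  define z :: int where "z = numeral ((half h ^^ S) x)"
  have "numeral (inc_halves h s x) = z + 1"
    by (simp only: inc_halves_def iterate_eq_funpow assms z_def numeral_inc)
  then have eq: "2 ^ (S * Suc j) * numeral (inc_halves h s x) = 2 ^ (S * j) * (2 ^ S * z) + 2 ^ (S * Suc j)"
    by (simp only: distrib_left mult_Suc_right power_add mult.assoc mult_1_right mult.left_commute)
  have "[2 ^ (S * j) * (2 ^ S * z) = 2 ^ (S * j) * numeral x] (mod D)"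
    unfolding z_def by (intro cong_scalar_left cong_funpow_half assms)
  also have "[2 ^ (S * j) * numeral x = (\<Sum>i<Suc j. 2 ^ (S * i))] (mod D)"
    using Suc.IH unfolding x_def .
  finally have "[2 ^ (S * j) * (2 ^ S * z) + 2 ^ (S * Suc j) =
      (\<Sum>i<Suc j. 2 ^ (S * i)) + 2 ^ (S * Suc j)] (mod D)"
    by (intro cong_add cong_refl)
  then show ?case
    by (simp only: funpow.simps o_apply x_def[symmetric] eq sum.lessThan_Suc[of _ "Suc j"])
qed simp

definition num_of :: "int \<Rightarrow> num" where
  "num_of k = num_of_nat (nat k)"

lemma nat_numeral_num_of: "0 < k \<Longrightarrow> numeral (num_of k) = nat k"
  by (simp add: num_of_def numeral_num_of_nat)

lemma numeral_num_of: "0 < k \<Longrightarrow> numeral (num_of k) = k"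
  using nat_numeral_num_of[of k] by (metis int_nat_eq of_nat_numeral order_less_le)

text \<open>
  An evaluation shortcut: on positive integer literals \<^const>\<open>num_of\<close> just strips a constructor.
\<close>

definition num_of_code_integer :: "integer \<Rightarrow> num" where
  "num_of_code_integer k = num_of (int_of_integer k)"

lemma num_of_code [code]:
  "num_of i = num_of_code_integer (integer_of_int i)"
  "num_of_code_integer 0 = num.One" "num_of_code_integer (Code_Numeral.Pos k) = k"
  "num_of_code_integer (Code_Numeral.Neg k) = num.One"
  by (simp_all add: num_of_def num_of_code_integer_def nat_of_num_inverse flip: nat_of_num_numeral)

text \<open>
  Starting from 1, the map \<open>x \<mapsto> 1 + x / 2^s\<close> with \<open>s = n / r\<close>, applied \<open>r - 1\<close> times modulo \<open>d\<close>, yields a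
  power of 1/2 times \<open>(2^n - 1) / (2^s - 1)\<close>. If this vanishes and \<open>r\<close> does not divide \<open>d\<close>, no prime
  divisor of \<open>d\<close> divides \<open>2^s - 1\<close>. The representative stays in \<open>{1..d + 1}\<close>, so zero shows up as \<open>d\<close>.
\<close>

definition order_check_at :: "int \<Rightarrow> int \<Rightarrow> int \<Rightarrow> bool" where
  "order_check_at n d r \<longleftrightarrow> (if r dvd n then \<not> r dvd d \<and>
     iterate (num_of (r - 1)) (inc_halves (num_of ((d + 1) div 2)) (num_of (n div r))) num.One = num_of d else True)"

lemma order_check_at_sound:
  assumes "order_check_at n d r" "odd d" "d > 1" "n > 0" "r dvd n" "r > 1"
  shows "d dvd (\<Sum>i<nat r. 2 ^ (nat (n div r) * i))" and "\<not> r dvd d"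
proof -
  let ?h = "num_of ((d + 1) div 2)" and ?s = "num_of (n div r)"
  have pos: "n div r > 0" "(d + 1) div 2 > 0" "r - 1 > 0"
    using assms by (auto simp: pos_imp_zdiv_pos_iff zdvd_imp_le)
  show "\<not> r dvd d"
    using assms by (auto simp: order_check_at_def)
  have "(inc_halves ?h ?s ^^ nat (r - 1)) num.One = num_of d"
    using assms pos by (simp add: order_check_at_def iterate_eq_funpow nat_numeral_num_of)
  moreover have "2 * ((d + 1) div 2) = d + 1"
    using assms by (intro dvd_mult_div_cancel) simp
  moreover have "numeral ?h = (d + 1) div 2" "numeral ?s = nat (n div r)" "numeral (num_of d) = d"
    using pos assms by (simp_all only: nat_numeral_num_of numeral_num_of)
  \<comment> \<open>\<open>r - 1\<close> steps from 1 produce \<open>r\<close> terms, and the final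
    value \<open>d\<close> makes the left side a multiple of \<open>d\<close>.\<close>
  ultimately have "[2 ^ (nat (n div r) * nat (r - 1)) * d =
      (\<Sum>i<Suc (nat (r - 1)). 2 ^ (nat (n div r) * i))] (mod d)"
    using cong_funpow_inc_halves[of ?h d ?s "nat (n div r)" "nat (r - 1)"] by simp
  moreover have "Suc (nat (r - 1)) = nat r"
    using assms by simp
  ultimately show "d dvd (\<Sum>i<nat r. 2 ^ (nat (n div r) * i))"
    by (metis cong_dvd_iff dvd_triv_right dvd_refl)
qed

lemma prime_dvd_modulus_cases:
  fixes p :: nat
  assumes "prime p" "p dvd 2027025"
  shows "p \<in> {3, 5, 7, 11, 13}"
proof -
  \<comment> \<open>2027025 is the least common multiple of the moduli in
    \<open>entries\<close>.\<close>
  have "p dvd 3 ^ 4 * 5\<^sup>2 * 7 * 11 * 13"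
    using assms(2) by simp
  then have "p dvd 3 \<or> p dvd 5 \<or> p dvd 7 \<or> p dvd 11 \<or> p dvd 13"
    using assms(1) by (auto simp only: prime_dvd_mult_iff dest: prime_dvd_power)
  moreover have "prime (3 :: nat)" "prime (5 :: nat)" "prime (7 :: nat)" "prime (11 :: nat)" "prime (13 :: nat)"
    by simp_all
  ultimately show ?thesis
    using assms(1) primes_dvd_imp_eq by blast
qed

fun order_check :: "int \<times> int \<times> int \<Rightarrow> bool" where
  "order_check (n, b, d) \<longleftrightarrow> odd d \<and> d > 1 \<and> n > 1 \<and> n dvd 2027025 \<and>
     list_all (order_check_at n d) [3, 5, 7, 11, 13]"

lemma order_check_sound:
  assumes "order_check (n, b, d)" "prime p" "int p dvd d"
  shows "ord p 2 = nat n"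
proof -
  have d: "odd d" "d > 1" and "n > 1" "n dvd 2027025"
    using assms(1) by auto
  then obtain N where N: "n = int N" "N > 1" "N dvd 2027025"
    by (intro that[of "nat n"]) (auto simp: nat_dvd_iff)
  have "ord p 2 = N"
  proof (rule ord_two_eqI)
    fix r assume r: "prime r" "r dvd N"
    then have "r \<in> {3, 5, 7, 11, 13}"
      using N prime_dvd_modulus_cases dvd_trans by blast
    then have "order_check_at n d (int r)"
      using assms(1) by auto
    then have sum: "d dvd (\<Sum>i<r. 2 ^ (N div r * i))" and nd: "\<not> int r dvd d"
      using order_check_at_sound[of n d "int r"] d N r prime_gt_1_nat[OF r(1)]
      by (auto simp flip: zdiv_int)
    have "int p dvd int (\<Sum>i<r. 2 ^ (N div r * i))"
      using dvd_trans[OF assms(3) sum] by simp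
    then have "p dvd (\<Sum>i<r. 2 ^ (N div r * i))"
      by (simp only: int_dvd_int_iff)
    \<comment> \<open>For primes, \<open>p dvd r\<close> means \<open>p = r\<close>, and then
      \<open>r\<close> would divide \<open>d\<close>.\<close>
    moreover have "\<not> p dvd r"
      using nd assms r by (metis primes_dvd_imp_eq)
    ultimately show "p dvd (\<Sum>i<r. 2 ^ (N div r * i)) \<and> \<not> p dvd r"
      by simp
  qed (use assms N in simp_all)
  then show ?thesis
    by (simp add: N)
qed

subsection \<open>Certified covers\<close>

text \<open>The lowest k digits in base p determine a number modulo p^k; the congruences modulo
  prime powers are combined by comparing multiplicities in \<open>n\<close> and x - b.\<close>

lemma cong_of_digits:
  fixes n b x :: nat
  assumes "n > 0" and digits: "\<And>p j. prime p \<Longrightarrow> p ^ Suc j dvd n \<Longrightarrow> (x div p ^ j) mod p = (b div p ^ j) mod p"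
  shows "[x = b] (mod n)"
proof -
  have pow: "[x = b] (mod p ^ j)" if "prime p" "p ^ j dvd n" for p j
    using that(2)
  proof (induction j)
    case (Suc j)
    then have "[x = b] (mod p ^ j)"
      using power_le_dvd le_SucI by blast
    moreover have "(x div p ^ j) mod p = (b div p ^ j) mod p"
      using digits that(1) Suc.prems by blast
    ultimately show ?case
      by (simp add: cong_def mult.commute[of p] mod_mult2_eq)
  qed simp
  show ?thesis
  proof (cases "x = b")
    case False
    then have nz: "int x - int b \<noteq> 0" by simp
    have "int n dvd int x - int b"
    proof (rule multiplicity_le_imp_dvd)
      fix q :: int assume "prime q"
      then obtain p where p: "q = int p" "prime p"
        by (metis prime_int_nat_transfer prime_ge_0_int nat_0_le)
      let ?e = "multiplicity q (int n)"
      have "int (p ^ ?e) dvd int n"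
        using multiplicity_dvd[of q "int n"] by (simp add: p)
      then have "[x = b] (mod p ^ ?e)"
        using pow[OF p(2)] by (simp only: int_dvd_int_iff)
      then have "int (p ^ ?e) dvd int x - int b"
        by (simp only: cong_iff_dvd_diff flip: cong_int_iff)
      then show "?e \<le> multiplicity q (int x - int b)"
        using nz \<open>prime q\<close> p by (intro multiplicity_geI) (auto simp: not_prime_unit)
    qed (use assms in simp)
    then show ?thesis
      by (metis cong_iff_dvd_diff cong_int_iff)
  qed simp
qed

text \<open>
  A residue class is encoded by prescribing some digits of a mixed radix expansion; \<open>None\<close> and missing
  trailing entries leave a digit free.
\<close>

fun matches :: "'a option list \<Rightarrow> 'a list \<Rightarrow> bool" where
  "matches [] xs = True"
| "matches (c # cs) [] = False"
| "matches (None # cs) (x # xs) = matches cs xs"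
| "matches (Some i # cs) (x # xs) = (x = i \<and> matches cs xs)"

text \<open>These are the patterns left for the remaining digits once the leading one is
  \<open>i\<close>; an empty pattern constrains nothing and survives.\<close>

fun restrict_patterns :: "'a \<Rightarrow> 'a option list list \<Rightarrow> 'a option list list" where
  "restrict_patterns i [] = []"
| "restrict_patterns i ([] # R) = [] # restrict_patterns i R"
| "restrict_patterns i ((None # c) # R) = c # restrict_patterns i R"
| "restrict_patterns i ((Some j # c) # R) = (if i = j then c # restrict_patterns i R else restrict_patterns i R)"

fun has_nil :: "'a list list \<Rightarrow> bool" where
  "has_nil [] = False"
| "has_nil ([] # R) = True"
| "has_nil ((x # c) # R) = has_nil R"

fun branches :: "'a list \<Rightarrow> 'a option list list \<Rightarrow> 'a option list list list" where
  "branches [] R = []"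
| "branches (i # is) R = restrict_patterns i R # branches is R"

fun exhaustive :: "'a list list \<Rightarrow> 'a option list list \<Rightarrow> bool" where
  "exhaustive [] R = has_nil R"
| "exhaustive (D # Ds) R = (if has_nil R then True else if R = [] then False
     else list_all (exhaustive Ds) (branches D R))"

lemma has_nil_iff: "has_nil R \<longleftrightarrow> [] \<in> set R"
  by (induction R rule: has_nil.induct) auto

lemma restrict_patterns_matches:
  "c \<in> set (restrict_patterns i R) \<Longrightarrow> matches c xs \<Longrightarrow> \<exists>c'\<in>set R. matches c' (i # xs)"
  by (induction i R rule: restrict_patterns.induct) (auto split: if_splits)

lemma exhaustive_sound:
  "exhaustive Ds R \<Longrightarrow> list_all2 (\<lambda>x D. x \<in> set D) xs Ds \<Longrightarrow> \<exists>c\<in>set R. matches c xs"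
proof (induction Ds arbitrary: R xs)
  case Nil
  then show ?case by (force simp: has_nil_iff)
next
  case (Cons D Ds)
  from Cons.prems(2) obtain x ys where xs: "xs = x # ys" "x \<in> set D" "list_all2 (\<lambda>x D. x \<in> set D) ys Ds"
    by (cases xs) auto
  show ?case
  proof (cases "has_nil R")
    case True
    then show ?thesis by (force simp: has_nil_iff)
  next
    case False
    have "branches D R = map (\<lambda>i. restrict_patterns i R) D"
      by (induction D) auto
    with False Cons.prems(1) xs have "exhaustive Ds (restrict_patterns x R)"
      by (auto simp: list_all_iff split: if_splits)
    then obtain c where "c \<in> set (restrict_patterns x R)" "matches c ys"
      using Cons.IH xs by blast
    then show ?thesis
      unfolding xs by (rule restrict_patterns_matches)
  qed
qed

text \<open>Without trailing \<open>None\<close> a pattern becomes empty once its last prescribed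
  digit is consumed, so \<open>exhaustive\<close> can close the branch there.\<close>

fun strip_none :: "'a option list \<Rightarrow> 'a option list" where
  "strip_none [] = []"
| "strip_none (Some i # c) = Some i # strip_none c"
| "strip_none (None # c) = (case strip_none c of [] \<Rightarrow> [] | x # y \<Rightarrow> None # x # y)"

text \<open>The length bound is there because \<open>matches\<close> rejects a pattern longer than
  the digit list even if the excess entries are \<open>None\<close>.\<close>

lemma matches_strip_none: "length c \<le> length xs \<Longrightarrow> matches (strip_none c) xs \<longleftrightarrow> matches c xs"
proof (induction c arbitrary: xs rule: strip_none.induct)
  case (2 i c)
  then show ?case by (cases xs) auto
next
  case (3 c)
  then obtain x ys where "xs = x # ys"
    by (cases xs) auto
  with 3 show ?case 
    by (auto split: list.splits simp del: matches.simps(1) simp: matches.simps(1))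
qed simp

text \<open>
  The pair \<open>(p, q)\<close> stands for the digit \<open>(x div q) mod p\<close>. The order keeps the search tree of
  \<^const>\<open>exhaustive\<close> small.
\<close>

definition levels :: "(int \<times> int) list" where
  "levels = [(3, 1), (5, 1), (3, 3), (7, 1), (5, 5), (3, 9), (3, 27), (11, 1), (13, 1)]"

text \<open>For \<open>q\<close> a power of the prime \<open>p\<close>, the class of
  \<open>b\<close> modulo \<open>n\<close> fixes the digit at \<open>q\<close> exactly when
  \<open>p * q\<close> divides \<open>n\<close>.\<close>

fun digit_of :: "int \<Rightarrow> int \<Rightarrow> int \<times> int \<Rightarrow> int option" where
  "digit_of n b (p, q) = (if p * q dvd n then Some ((b div q) mod p) else None)"

fun pattern :: "int \<times> int \<times> int \<Rightarrow> int option list" where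
  "pattern (n, b, d) = strip_none (map (digit_of n b) levels)"

lemma levels_complete:
  fixes p :: nat
  assumes "prime p" "p ^ Suc j dvd 2027025"
  shows "(int p, int (p ^ j)) \<in> set levels"
proof -
  have "p \<in> {3, 5, 7, 11, 13}"
    by (rule prime_dvd_modulus_cases[OF assms(1)]) (use assms(2) in \<open>auto elim: dvd_mult_left\<close>)
  moreover have "j < 4"
  proof (rule ccontr)
    assume "\<not> j < 4"
    then have "p ^ 5 dvd 2027025"
      by (intro power_le_dvd[OF assms(2)]) simp
    with calculation show False
      by auto
  qed
  then have "j \<in> {0, 1, 2, 3}"
    by auto
  ultimately show ?thesis
    using assms(2) by (elim insertE emptyE) (simp_all add: levels_def)
qed

lemma matches_map_digit_of:
  "matches (map (digit_of n b) ls) (map (\<lambda>(p, q). (x div q) mod p) ls) \<longleftrightarrow>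
     (\<forall>(p, q)\<in>set ls. p * q dvd n \<longrightarrow> (x div q) mod p = (b div q) mod p)"
  by (induction ls) (auto split: if_splits)

text \<open>Each prime power above 1 dividing \<open>n\<close> belongs to a level whose digit the
  pattern prescribes.\<close>

lemma cong_of_matches_pattern:
  fixes n b x :: nat
  assumes "matches (pattern (int n, int b, d)) (map (\<lambda>(p, q). (int x div q) mod p) levels)"
    and n: "n > 0" "n dvd 2027025"
  shows "[x = b] (mod n)"
proof (rule cong_of_digits[OF n(1)])
  fix p j assume p: "prime p" "p ^ Suc j dvd n"
  have "(int p, int (p ^ j)) \<in> set levels"
    using levels_complete[OF p(1)] p(2) n(2) dvd_trans by blast
  moreover have "int p * int (p ^ j) dvd int n"
    using p(2) by (simp only: int_dvd_int_iff power_Suc flip: of_nat_mult)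
  ultimately have "(int x div int (p ^ j)) mod int p = (int b div int (p ^ j)) mod int p"
    using assms(1) by (fastforce simp: matches_strip_none matches_map_digit_of)
  then show "(x div p ^ j) mod p = (b div p ^ j) mod p"
    by (simp only: of_nat_eq_iff flip: zdiv_int zmod_int)
qed

subsection \<open>The cover and the auxiliary primes\<close>

text \<open>
  A triple \<open>(n, b, d)\<close> stands for the class \<open>b mod n\<close> and a factor \<open>d > 1\<close> of \<open>2^n - 1\<close>, not necessarily
  prime, modulo every prime divisor of which 2 has order \<open>n\<close>. The classes were found by a randomised
  greedy search.
\<close>

definition entries :: "(int \<times> int \<times> int) list" where
  "entries = [
    (3, 0, 7), (5, 3, 31), (7, 6, 127), (9, 5, 73), (11, 8, 23), (11, 0, 89), (13, 3, 8191),
    (15, 1, 151), (21, 7, 337), (25, 0, 601), (25, 5, 1801), (27, 8, 262657), (33, 10, 599479),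
    (35, 2, 71), (35, 22, 122921), (39, 2, 79), (39, 38, 121369), (45, 29, 631), (45, 11, 23311),
    (55, 39, 881), (55, 49, 3191), (55, 4, 201961), (63, 31, 92737), (63, 10, 649657),
    (65, 35, 145295143558111), (75, 40, 100801), (75, 10, 10567201),
    (77, 25, 581283643249112959), (81, 71, 2593), (81, 17, 71119), (81, 44, 97685839),
    (91, 5, 911), (91, 89, 112901153), (91, 33, 23140471537), (99, 79, 199), (99, 97, 153649),
    (99, 34, 33057806959), (105, 67, 29191), (105, 82, 106681), (105, 64, 152041),
    (117, 47, 937), (117, 92, 6553), (117, 110, 86113), (117, 56, 7830118297), (135, 26, 271),
    (135, 134, 348031), (135, 107, 49971617830801), (165, 139, 2048568835297380486760231),
    (175, 170, 39551), (175, 120, 60816001), (175, 95, 535347624791488552837151),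
    (189, 115, 1560007), (189, 52, 207617485544258392970753527),
    (195, 152, 134304196845099262572814573351), (225, 110, 115201), (225, 65, 617401),
    (225, 215, 1348206751), (225, 35, 13861369826299351), (231, 58, 463),
    (231, 124, 4982397651178256151338302204762057), (273, 206, 108749551),
    (273, 161, 4093204977277417), (273, 245, 86977595801949844993), (297, 145, 8950393),
    (297, 46, 170886618823141738081830950807292771648313599433), (315, 137, 870031),
    (315, 4, 983431), (315, 184, 29728307155963706810228435378401), (325, 195, 7151),
    (351, 218, 446473), (351, 101, 29121769), (351, 335, 571890896913727), (385, 89, 55441),
    (385, 229, 1971764055031), (405, 244, 537841), (405, 379, 11096527935003481),
    (405, 109, 17645665556213400107370602081155737281406841), (455, 122, 200201), (495, 64, 991),
    (525, 145, 4201), (525, 395, 7351), (525, 245, 181165951), (585, 137, 2400314671),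
    (585, 182, 339175003117573351), (675, 70, 1605151), (693, 607, 289511839),
    (693, 100, 2868251407519807), (1155, 529, 2311), (1155, 577, 6250631311),
    (1485, 1447, 19694071), (1575, 845, 82013401), (2079, 367, 4159), (2079, 1312, 16633),
    (2079, 1690, 80932047967)]"

text \<open>Entries with different \<open>n\<close> yield primes with different orders of 2, so only
  entries with equal \<open>n\<close> could share a prime.\<close>

fun coprime_check :: "int \<times> int \<times> int \<Rightarrow> int \<times> int \<times> int \<Rightarrow> bool" where
  "coprime_check (n, b, d) (n', b', d') \<longleftrightarrow> (if n = n' then gcd d d' = 1 else True)"

fun digits_below :: "int \<times> int \<Rightarrow> int list" where
  "digits_below (p, q) = [0..p - 1]"

fun nonneg_residue :: "int \<times> int \<times> int \<Rightarrow> bool" where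
  "nonneg_residue (n, b, d) \<longleftrightarrow> b \<ge> 0"

lemma entries_nonneg: "list_all nonneg_residue entries"
  by code_simp

lemma entries_order: "list_all order_check entries"
  by code_simp

lemma entries_coprime: "sorted_wrt coprime_check entries"
  by code_simp

lemma entries_exhaustive: "exhaustive (map digits_below levels) (map pattern entries)"
  by code_simp

lemma length_entries: "length entries = 94"
  by (simp add: entries_def)

section \<open>Modular powers of 2 and trial division\<close>

definition square_mod :: "int \<Rightarrow> int \<Rightarrow> int" where
  "square_mod q x = x * x mod q"

fun two_power_mod :: "int \<Rightarrow> num \<Rightarrow> int" where
  "two_power_mod q num.One = 2 mod q"
| "two_power_mod q (num.Bit0 k) = square_mod q (two_power_mod q k)"
| "two_power_mod q (num.Bit1 k) = 2 * square_mod q (two_power_mod q k) mod q"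

lemma two_power_mod: "two_power_mod q k = 2 ^ numeral k mod q"
proof (induction k)
  case (Bit0 k)
  then show ?case
    by (simp only: two_power_mod.simps square_mod_def numeral_Bit0 power_add mod_mult_eq)
next
  case (Bit1 k)
  then have "square_mod q (two_power_mod q k) = 2 ^ numeral k * 2 ^ numeral k mod q"
    by (simp only: square_mod_def mod_mult_eq)
  then show ?case
    by (simp only: two_power_mod.simps numeral_Bit1 power_add power_one_right mod_mult_right_eq
        mult.commute[of _ 2])
qed simp

lemma not_ord_two_dvd:
  fixes q k :: nat
  assumes "two_power_mod (int q) (num_of (int k)) \<noteq> 1" "q > 1" "k > 0"
  shows "\<not> ord q 2 dvd k"
proof
  assume "ord q 2 dvd k"
  then have "[2 ^ k = 1] (mod q)"
    by (simp add: ord_divides')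
  then have "[2 ^ k = 1] (mod int q)"
    by (metis cong_int_iff of_nat_1 of_nat_numeral of_nat_power)
  then show False
    using assms by (simp add: two_power_mod nat_numeral_num_of cong_def)
qed

text \<open>Of two complementary divisors of \<open>q\<close> one is at most \<open>b\<close>. The
  exception \<open>r = q\<close> admits primes \<open>q\<close> up to \<open>b\<close>.\<close>

lemma prime_if_no_small_divisor:
  fixes q b :: nat
  assumes "q > 1" "q < (b + 1)\<^sup>2"
    and small: "\<And>r. 2 \<le> r \<Longrightarrow> r \<le> b \<Longrightarrow> r dvd q \<Longrightarrow> r = q"
  shows "prime q"
proof -
  have "m = 1 \<or> m = q" if "m dvd q" for m
  proof -
    obtain k where k: "q = m * k"
      using \<open>m dvd q\<close> by (elim dvdE)
    have "m \<le> b \<or> k \<le> b"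
    proof (rule ccontr)
      assume "\<not> ?thesis"
      then have "(b + 1) * (b + 1) \<le> m * k"
        by (intro mult_le_mono) auto
      then show False
        using assms(2) k by (simp add: power2_eq_square)
    qed
    moreover have "m > 0" "k > 0"
      using k assms(1) by (auto intro!: Nat.gr0I)
    ultimately show ?thesis
      using small[of m] small[of k] k assms(1) by (cases "m = 1"; cases "k = 1") auto
  qed
  then show ?thesis
    using assms(1) by (simp add: prime_nat_iff)
qed

text \<open>
  The least 53 primes \<open>q\<close> such that \<open>q - 1\<close> divides \<open>4324320 = 2^5 * 3^3 * 5 * 7 * 11 * 13\<close> and 2 has even
  order modulo \<open>q\<close>. They suffice because \<open>3 * 94 * 4324320^2 < 2^53\<close>.
\<close>

definition auxiliary_primes :: "int list" where
  "auxiliary_primes = [3, 5, 11, 13, 17, 19, 29, 37, 41, 43, 53, 61, 67, 97, 109, 113, 131, 157, 181,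
     211, 241, 281, 313, 331, 353, 379, 397, 421, 433, 521, 541, 547, 617, 661, 673, 757, 859, 1009,
     1093, 1171, 1249, 1321, 1873, 2003, 2017, 2081, 2161, 2341, 2377, 2521, 2731, 2861, 2971]"

definition no_proper_divisor :: "int \<Rightarrow> int \<Rightarrow> bool" where
  "no_proper_divisor q r \<longleftrightarrow> (if r dvd q then r = q else True)"

text \<open>Trial division up to 54 suffices below 3025 = 55^2. The last condition keeps the order
  of 2 modulo \<open>q\<close> from dividing 2027025, which separates \<open>q\<close> from the
  primes of the cover.\<close>

definition auxiliary_check :: "int \<Rightarrow> bool" where
  "auxiliary_check q \<longleftrightarrow> odd q \<and> 1 < q \<and> q < 3025 \<and> q - 1 dvd 4324320 \<and>
     list_all (no_proper_divisor q) [2..54] \<and> two_power_mod q (num_of 2027025) \<noteq> 1"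

lemma auxiliary_primes_check: "list_all auxiliary_check auxiliary_primes"
  by code_simp

lemma auxiliary_check_sound:
  fixes q :: nat
  assumes "auxiliary_check (int q)"
  shows "prime q" "odd q" "q - 1 dvd 4324320" "\<not> ord q 2 dvd 2027025"
proof -
  have q: "1 < q" "q < 3025" "odd q" "int q - 1 dvd 4324320"
    using assms by (auto simp: auxiliary_check_def)
  have no: "r = q" if "2 \<le> r" "r \<le> 54" "r dvd q" for r
  proof -
    have "no_proper_divisor (int q) (int r)"
      using assms that by (auto simp: auxiliary_check_def list_all_iff simp del: upto_rec_numeral)
    then show ?thesis
      using that by (simp add: no_proper_divisor_def)
  qed
  show "prime q"
    by (rule prime_if_no_small_divisor[of q 54]) (use q no in auto)
  show "odd q" by fact
  have "int (q - 1) dvd int 4324320"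
    using q by (simp add: of_nat_diff)
  then show "q - 1 dvd 4324320"
    by (simp only: int_dvd_int_iff)
  show "\<not> ord q 2 dvd 2027025"
    using assms q by (intro not_ord_two_dvd) (simp_all add: auxiliary_check_def)
qed

lemma length_auxiliary_primes: "length auxiliary_primes = 53"
  by (simp add: auxiliary_primes_def)

lemma distinct_auxiliary_primes: "distinct auxiliary_primes"
  by code_simp

section \<open>From the certificates to the theorem\<close>

lemma entriesD:
  assumes "(n, b, d) \<in> set entries"
  shows "n > 1" "n dvd 2027025" "b \<ge> 0" "odd d" "d > 1" "order_check (n, b, d)"
proof -
  show oc: "order_check (n, b, d)"
    using assms entries_order by (simp only: list_all_iff)
  then show "n > 1" "n dvd 2027025" "odd d" "d > 1"
    by simp_all
  have "nonneg_residue (n, b, d)"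
    using assms entries_nonneg by (simp only: list_all_iff)
  then show "b \<ge> 0"
    by simp
qed

lemma entries_coprimeD:
  assumes "(n, b, d) \<in> set entries" "(n, b', d') \<in> set entries" "(b, d) \<noteq> (b', d')"
  shows "coprime d d'"
proof -
  obtain i j where ij: "i < length entries" "j < length entries" "entries ! i = (n, b, d)" "entries ! j = (n, b', d')"
    using assms by (meson in_set_conv_nth)
  with assms(3) have "i < j \<or> j < i"
    by (cases i j rule: linorder_cases) auto
  then have "coprime_check (n, b, d) (n, b', d') \<or> coprime_check (n, b', d') (n, b, d)"
    using entries_coprime ij by (metis sorted_wrt_iff_nth_less)
  then show ?thesis
    by (auto simp: coprime_iff_gcd_eq_1 gcd.commute)
qed

lemma entries_cover:
  fixes x :: nat
  shows "\<exists>(n, b, d)\<in>set entries. [x = nat b] (mod nat n)"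
proof -
  have "\<forall>(p, q)\<in>set levels. p > 0"
    by (simp add: levels_def)
  then have "\<forall>l\<in>set levels. (\<lambda>(p, q). (int x div q) mod p) l \<in> set (digits_below l)"
    by (auto simp: zle_diff1_eq)
  then have "list_all2 (\<lambda>x D. x \<in> set D) (map (\<lambda>(p, q). (int x div q) mod p) levels) (map digits_below levels)"
    by (simp only: list_all2_map1 list_all2_map2 list_all2_same)
  from exhaustive_sound[OF entries_exhaustive this]
  obtain n b d where e: "(n, b, d) \<in> set entries"
    and m: "matches (pattern (n, b, d)) (map (\<lambda>(p, q). (int x div q) mod p) levels)"
    by auto
  have "[x = nat b] (mod nat n)"
    using m entriesD[OF e] by (intro cong_of_matches_pattern[of _ _ d]) (simp_all add: nat_dvd_iff)
  with e show ?thesis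
    by blast
qed

theorem theorem1p2:
  fixes N :: nat
  assumes "N \<ge> 1"
  shows "\<exists>a M :: int. M \<ge> 1 \<and>
    (\<forall>x \<in> {x :: int. [x = a] (mod M)}. odd x) \<and>
    (\<forall>x \<in> {x :: int. [x = a] (mod M)}. x \<ge> 0 \<longrightarrow>
      (\<forall>m \<in> {1..N}. (\<forall>p \<in> {3, 5, 7, 11, 13}. \<not> p dvd m) \<longrightarrow>
        (\<forall>n :: nat. card (prime_factors (x ^ m - 2 ^ n)) \<ge> 2)))"
proof -
  have "\<exists>p. prime p \<and> int p dvd snd (snd x)" if x: "x \<in> set entries" for x
  proof -
    obtain n b d where nbd: "x = (n, b, d)"
      by (cases x)
    then have "d > 1"
      using entriesD(5) x by blast
    then have "nat d \<noteq> 1"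
      by simp
    then obtain p where "prime p" "p dvd nat d"
      using prime_factor_nat by blast
    then have "int p dvd int (nat d)"
      by (simp only: int_dvd_int_iff)
    then show ?thesis
      using \<open>d > 1\<close> \<open>prime p\<close> nbd by auto
  qed
  then obtain pr where pr': "\<And>x. x \<in> set entries \<Longrightarrow> prime (pr x) \<and> int (pr x) dvd snd (snd x)"
    by metis
  have pr: "prime (pr (n, b, d))" "int (pr (n, b, d)) dvd d" if "(n, b, d) \<in> set entries" for n b d
    using pr'[OF that] by simp_all
  have ord: "ord (pr (n, b, d)) 2 = nat n" if "(n, b, d) \<in> set entries" for n b d
    using order_check_sound entriesD(6)[OF that] pr[OF that] by blast
  \<comment> \<open>A prime shared by two entries has one order of 2, so their \<open>n\<close>
    agree, and then distinct entries have coprime \<open>d\<close>. Injectivity lets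
    \<open>g\<close> recover the entry of a prime.\<close>
  have inj: "inj_on pr (set entries)"
  proof (rule inj_onI)
    fix x y
    assume xy: "x \<in> set entries" "y \<in> set entries" "pr x = pr y"
    obtain n b d n' b' d' where nbd: "x = (n, b, d)" "y = (n', b', d')"
      by (metis prod_cases3)
    note e = xy(1,2)[unfolded nbd] and eq = xy(3)[unfolded nbd]
    have "nat n = nat n'"
      using ord[OF e(1)] ord[OF e(2)] eq by simp
    then have n: "n = n'"
      using entriesD(1)[OF e(1)] entriesD(1)[OF e(2)] by simp
    have "\<not> coprime d d'"
      using pr[OF e(1)] pr[OF e(2)] eq by (metis coprime_common_divisor not_prime_unit prime_nat_int_transfer)
    then show "x = y"
      using entries_coprimeD[of n b d b' d'] e n nbd by auto
  qed
  define g where "g = inv_into (set entries) pr"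
  define e r where "e = (\<lambda>p. nat (fst (g p)))" and "r = (\<lambda>p. nat (fst (snd (g p))))"
  have g: "g (pr x) = x" if "x \<in> set entries" for x
    unfolding g_def using inj that by (rule inv_into_f_f)
  define Q where "Q = nat ` set auxiliary_primes"
  have Q: "prime q \<and> odd q \<and> q - 1 dvd 4324320 \<and> \<not> ord q 2 dvd 2027025" if q: "q \<in> Q" for q
  proof -
    obtain q' where q': "q' \<in> set auxiliary_primes" "q = nat q'"
      using q by (auto simp: Q_def)
    then have "auxiliary_check q'"
      using auxiliary_primes_check by (simp only: list_all_iff)
    moreover from this have "q' = int q"
      by (simp add: q' auxiliary_check_def)
    ultimately show ?thesis
      using auxiliary_check_sound by blast
  qed
  have P: "prime p \<and> odd p \<and> [2 ^ e p = 1] (mod p) \<and> e p dvd 2027025 \<and> ord p 2 = e p"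
    if p: "p \<in> pr ` set entries" for p
  proof -
    obtain n b d where nbd: "(n, b, d) \<in> set entries" "p = pr (n, b, d)"
      using p by auto
    have "e p = nat n"
      by (simp add: e_def nbd g)
    moreover have "odd p"
      using dvd_trans[of 2 "int p" d] pr(2)[OF nbd(1)] entriesD(4)[OF nbd(1)] nbd(2) by auto
    moreover have "nat n dvd 2027025"
      using entriesD[OF nbd(1)] by (simp add: nat_dvd_iff)
    ultimately show ?thesis
      using pr[OF nbd(1)] ord[OF nbd(1)] nbd(2) by (auto simp: ord_divides')
  qed
  have "inj_on nat (set auxiliary_primes)"
    using auxiliary_primes_check by (auto simp: inj_on_def list_all_iff auxiliary_check_def simp del: upto_rec_numeral)
  then have "card Q = 53"
    using distinct_auxiliary_primes
    by (simp add: Q_def card_image distinct_card length_auxiliary_primes)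
  have "card (pr ` set entries) \<le> 94"
    using card_image_le[of "set entries" pr] card_length[of entries] by (simp add: length_entries)
  then have card: "3 * card (pr ` set entries) * 4324320\<^sup>2 < 2 ^ card Q"
    unfolding \<open>card Q = 53\<close> by simp
  have cover: "\<exists>p\<in>pr ` set entries. [x = r p] (mod e p)" for x
    using entries_cover[of x] g by (force simp: r_def e_def)
  \<comment> \<open>The order of 2 divides 2027025 for every cover prime and for no auxiliary
    prime.\<close>
  have disj: "pr ` set entries \<inter> Q = {}"
  proof (rule ccontr)
    assume "\<not> ?thesis"
    then obtain q where "q \<in> pr ` set entries" "q \<in> Q"
      by blast
    then have "ord q 2 dvd 2027025" "\<not> ord q 2 dvd 2027025"
      using P[of q] Q[of q] by simp_all
    then show False
      by blast
  qed
  have "\<exists>a M :: int. M \<ge> 1 \<and> (\<forall>x. [x = a] (mod M) \<longrightarrow> odd x \<and>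
      (\<forall>m n. coprime m (2027025 :: nat) \<longrightarrow> m \<ge> 1 \<longrightarrow> card (prime_factors (x ^ m - 2 ^ n)) \<ge> 2))"
  proof (rule progression_of_cover[OF _ _ _ cover _ _ disj card])
    show "prime p \<and> odd p \<and> [2 ^ e p = 1] (mod p) \<and> e p dvd 2027025" if "p \<in> pr ` set entries" for p
      using P[OF that] by blast
    show "prime q \<and> odd q \<and> q - 1 dvd 4324320" if "q \<in> Q" for q
      using Q[OF that] by blast
  qed (simp_all add: Q_def)
  then obtain a M :: int where "M \<ge> 1" and aM: "\<And>x. [x = a] (mod M) \<Longrightarrow> odd x \<and>
      (\<forall>m n. coprime m (2027025 :: nat) \<longrightarrow> m \<ge> 1 \<longrightarrow> card (prime_factors (x ^ m - 2 ^ n)) \<ge> 2)"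
    by blast
  moreover have "coprime m 2027025" if "\<forall>p\<in>{3, 5, 7, 11, 13}. \<not> p dvd m" for m :: nat
  proof (rule ccontr)
    assume "\<not> ?thesis"
    then have "gcd m 2027025 \<noteq> 1"
      by (simp only: coprime_iff_gcd_eq_1 not_False_eq_True)
    then obtain p where p: "prime p" "p dvd gcd m 2027025"
      using prime_factor_nat by blast
    then have "p \<in> {3, 5, 7, 11, 13}"
      using prime_dvd_modulus_cases dvd_trans gcd_dvd2 by blast
    then show False
      using p(2) that dvd_trans gcd_dvd1 by blast
  qed
  ultimately show ?thesis
    by (intro exI[of _ a] exI[of _ M]) auto
qed

end
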